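(* Let $s\in(0,1)$, $\mathbf v\in\mathbf H^s(\mathbb R^n)$ and $u\in H^s(\mathbb R^n)$. For the weight function and interaction kernel $$\omega(\mathbf x,\mathbf y)=|\mathbf y-\mathbf x|\,\phi(|\mathbf y-\mathbf x|),\quad \phi(|\mathbf y-\mathbf x|)=|\mathbf x-\mathbf y|^{-(n+1+s)},\qquad \boldsymbol\alpha(\mathbf x,\mathbf y)=\boldsymbol\rho(\mathbf x,\mathbf y)=\frac{\mathbf y-\mathbf x}{|\mathbf y-\mathbf x|}\quad(\text{i.e. }\delta=\infty),$$ the fractional divergence and gradient coincide with the weighted nonlocal divergence and gradient: $$\operatorname{div}^s\mathbf v(\mathbf x)=\mathcal D_\omega\mathbf v(\mathbf x),\qquad\operatorname{grad}^su(\mathbf x)=\mathcal G_\omega u(\mathbf x).$$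
   Context: Integrals are understood in the principal value sense where needed; $n\in\{1,2,3\}$. $\mathbf H^s(\mathbb R^n)$ denotes vector fields with all components in $H^s(\mathbb R^n)$. Interaction kernels have the form $\boldsymbol\alpha(\mathbf x,\mathbf y)=\boldsymbol\rho(\mathbf x,\mathbf y)\mathbf 1(|\mathbf x-\mathbf y|\le\delta)$ with $\boldsymbol\rho$ antisymmetric and vector-valued, $\delta\in(0,\infty]$. For a nonnegative symmetric weight $\omega$, the weighted nonlocal operators are $$\mathcal D_\omega\mathbf v(\mathbf x)=\int_{\mathbb R^n}\big(\omega(\mathbf x,\mathbf y)\mathbf v(\mathbf x)+\omega(\mathbf y,\mathbf x)\mathbf v(\mathbf y)\big)\cdot\boldsymbol\alpha(\mathbf x,\mathbf y)\,d\mathbf y,$$ for which the paper also uses the equivalent expression $\mathcal D_\omega\mathbf v(\mathbf x)=\int_{\mathbb R^n}(\mathbf v(\mathbf y)-\mathbf v(\mathbf x))\cdot\boldsymbol\alpha(\mathbf x,\mathbf y)\omega(\mathbf x,\mathbf y)\,d\mathbf y$, and $$\mathcal G_\omega u(\mathbf x)=\int_{\mathbb R^n}(u(\mathbf y)-u(\mathbf x))\boldsymbol\alpha(\mathbf x,\mathbf y)\omega(\mathbf x,\mathbf y)\,d\mathbf y.$$ The Cartesian fractional operators are $$\operatorname{grad}^su(\mathbf x)=\int_{\mathbb R^n}[u(\mathbf x)-u(\mathbf y)]\frac{\mathbf x-\mathbf y}{|\mathbf x-\mathbf y|}\frac{d\mathbf y}{|\mathbf x-\mathbf y|^{n+s}},\qquad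 \operatorname{div}^s\mathbf v(\mathbf x)=\int_{\mathbb R^n}[\mathbf v(\mathbf x)-\mathbf v(\mathbf y)]\cdot\frac{\mathbf x-\mathbf y}{|\mathbf x-\mathbf y|}\frac{d\mathbf y}{|\mathbf x-\mathbf y|^{n+s}}.$$ *)

theory Defs
  imports "HOL-Analysis.Analysis"
begin

text \<open>Principal value of an integral over \<open>\<real>\<^sup>n\<close> whose integrand may be singular at \<open>x\<close>: the limit
  of the absolutely convergent integrals over the complements of the balls of radius \<open>\<epsilon>\<close> around
  \<open>x\<close>. For Lebesgue integrable integrands it is the Lebesgue integral. As for the library
  integrals, the value is \<open>0\<close> where the principal value does not exist.\<close>

definition has_pv_integral ::
    "('a::euclidean_space \<Rightarrow> 'b::euclidean_space) \<Rightarrow> 'a \<Rightarrow> 'b \<Rightarrow> bool"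
  where "has_pv_integral f x I \<longleftrightarrow>
    (\<forall>\<epsilon>>0. set_integrable lebesgue {y. \<epsilon> < norm (y - x)} f) \<and>
    ((\<lambda>\<epsilon>. set_lebesgue_integral lebesgue {y. \<epsilon> < norm (y - x)} f) \<longlongrightarrow> I) (at_right 0)"

definition pv_integrable ::
    "('a::euclidean_space \<Rightarrow> 'b::euclidean_space) \<Rightarrow> 'a \<Rightarrow> bool"
  where "pv_integrable f x \<longleftrightarrow> (\<exists>I. has_pv_integral f x I)"

definition pv_integral ::
    "('a::euclidean_space \<Rightarrow> 'b::euclidean_space) \<Rightarrow> 'a \<Rightarrow> 'b"
  where "pv_integral f x = (if pv_integrable f x then (THE I. has_pv_integral f x I) else 0)"

text \<open>The Sobolev space \<open>H\<^sup>s(\<real>\<^sup>n)\<close> for \<open>0 < s < 1\<close>, given by square integrability and finiteness of the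
  Gagliardo seminorm. Its elements are functions, not classes modulo null sets.\<close>

definition sobolev_H :: "real \<Rightarrow> (real ^ 'n \<Rightarrow> real) set"
  where "sobolev_H s = {u. u \<in> borel_measurable lebesgue \<and> integrable lebesgue (\<lambda>x. (u x)\<^sup>2) \<and>
    (\<integral>\<^sup>+ x. (\<integral>\<^sup>+ y. ennreal ((u x - u y)\<^sup>2 / norm (x - y) powr (real CARD('n) + 2 * s))
      \<partial>lebesgue) \<partial>lebesgue) < \<infinity>}"

definition sobolev_H_vec :: "real \<Rightarrow> (real ^ 'n \<Rightarrow> real ^ 'n) set"
  where "sobolev_H_vec s = {v. \<forall>i. (\<lambda>x. v x $ i) \<in> sobolev_H s}"

definition interaction_kernel ::
    "(real ^ 'n \<Rightarrow> real ^ 'n \<Rightarrow> real ^ 'n) \<Rightarrow> ereal \<Rightarrow> real ^ 'n \<Rightarrow> real ^ 'n \<Rightarrow> real ^ 'n"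
  where "interaction_kernel \<rho> \<delta> x y = (if ereal (norm (x - y)) \<le> \<delta> then \<rho> x y else 0)"

text \<open>The integrands (as functions of \<open>y\<close>) are named separately from the operators, so that one can
  also speak about the existence of the principal values.\<close>

definition nonlocal_div_integrand ::
    "(real ^ 'n \<Rightarrow> real ^ 'n \<Rightarrow> real) \<Rightarrow> (real ^ 'n \<Rightarrow> real ^ 'n \<Rightarrow> real ^ 'n)
      \<Rightarrow> (real ^ 'n \<Rightarrow> real ^ 'n) \<Rightarrow> real ^ 'n \<Rightarrow> real ^ 'n \<Rightarrow> real"
  where "nonlocal_div_integrand \<omega> \<alpha> v x y = (\<omega> x y *\<^sub>R v x + \<omega> y x *\<^sub>R v y) \<bullet> \<alpha> x y"

definition nonlocal_div ::
    "(real ^ 'n \<Rightarrow> real ^ 'n \<Rightarrow> real) \<Rightarrow> (real ^ 'n \<Rightarrow> real ^ 'n \<Rightarrow> real ^ 'n)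
      \<Rightarrow> (real ^ 'n \<Rightarrow> real ^ 'n) \<Rightarrow> real ^ 'n \<Rightarrow> real"
  where "nonlocal_div \<omega> \<alpha> v x = pv_integral (nonlocal_div_integrand \<omega> \<alpha> v x) x"

definition nonlocal_grad_integrand ::
    "(real ^ 'n \<Rightarrow> real ^ 'n \<Rightarrow> real) \<Rightarrow> (real ^ 'n \<Rightarrow> real ^ 'n \<Rightarrow> real ^ 'n)
      \<Rightarrow> (real ^ 'n \<Rightarrow> real) \<Rightarrow> real ^ 'n \<Rightarrow> real ^ 'n \<Rightarrow> real ^ 'n"
  where "nonlocal_grad_integrand \<omega> \<alpha> u x y = ((u y - u x) * \<omega> x y) *\<^sub>R \<alpha> x y"

definition nonlocal_grad ::
    "(real ^ 'n \<Rightarrow> real ^ 'n \<Rightarrow> real) \<Rightarrow> (real ^ 'n \<Rightarrow> real ^ 'n \<Rightarrow> real ^ 'n)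
      \<Rightarrow> (real ^ 'n \<Rightarrow> real) \<Rightarrow> real ^ 'n \<Rightarrow> real ^ 'n"
  where "nonlocal_grad \<omega> \<alpha> u x = pv_integral (nonlocal_grad_integrand \<omega> \<alpha> u x) x"

definition frac_div_integrand ::
    "real \<Rightarrow> (real ^ 'n \<Rightarrow> real ^ 'n) \<Rightarrow> real ^ 'n \<Rightarrow> real ^ 'n \<Rightarrow> real"
  where "frac_div_integrand s v x y =
    ((v x - v y) \<bullet> ((x - y) /\<^sub>R norm (x - y))) / norm (x - y) powr (real CARD('n) + s)"

definition frac_div :: "real \<Rightarrow> (real ^ 'n \<Rightarrow> real ^ 'n) \<Rightarrow> real ^ 'n \<Rightarrow> real"
  where "frac_div s v x = pv_integral (frac_div_integrand s v x) x"

definition frac_grad_integrand ::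
    "real \<Rightarrow> (real ^ 'n \<Rightarrow> real) \<Rightarrow> real ^ 'n \<Rightarrow> real ^ 'n \<Rightarrow> real ^ 'n"
  where "frac_grad_integrand s u x y =
    ((u x - u y) *\<^sub>R ((x - y) /\<^sub>R norm (x - y))) /\<^sub>R norm (x - y) powr (real CARD('n) + s)"

definition frac_grad :: "real \<Rightarrow> (real ^ 'n \<Rightarrow> real) \<Rightarrow> real ^ 'n \<Rightarrow> real ^ 'n"
  where "frac_grad s u x = pv_integral (frac_grad_integrand s u x) x"

end

theory Submission
  imports Defs
begin

text \<open>The gradient integrands agree pointwise. With the symmetric weight the divergence integrands
  differ by \<open>2 v(x) \<bullet> (y - x) / |y - x|\<^sup>n\<^sup>+\<^sup>1\<^sup>+\<^sup>s\<close>, which is absolutely integrable off every ball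
  around \<open>x\<close> because \<open>s > 0\<close>, and odd under the reflection \<open>y \<mapsto> 2x - y\<close>; so its principal value
  is zero.\<close>

text \<open>The point reflection \<open>y \<mapsto> c - y\<close> preserves Lebesgue measure, so the
  integral equals its own negative. For non-integrable \<open>f\<close> the identities still hold,
  since every integral in the chain then has the default value 0.\<close>

lemma lborel_integral_odd_eq_0:
  fixes f :: "'a::euclidean_space \<Rightarrow> 'b::euclidean_space"
  assumes [measurable]: "f \<in> borel_measurable borel"
    and odd: "\<And>y. f (c - y) = - f y"
  shows "integral\<^sup>L lborel f = 0"
proof -
  \<comment> \<open>An affine map with factor -1 has Jacobian of modulus 1, so the density in the
    change of variables is constantly 1.\<close>
  have "lborel = distr lborel borel (\<lambda>y. c - y)"
    using lborel_affine[of "-1" c] by (simp add: density_1)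
  then have "integral\<^sup>L lborel f = integral\<^sup>L (distr lborel borel (\<lambda>y. c - y)) f"
    by (rule arg_cong)
  also have "\<dots> = (\<integral>y. f (c - y) \<partial>lborel)"
    by (rule integral_distr) auto
  also have "\<dots> = - integral\<^sup>L lborel f"
    by (simp add: odd)
  finally have "2 *\<^sub>R integral\<^sup>L lborel f = 0"
    by (simp add: scaleR_2 eq_neg_iff_add_eq_0)
  then show ?thesis by simp
qed

text \<open>Dyadic shells around \<open>x\<close>: where the distance is between
  \<open>2 ^ k * \<epsilon>\<close> and twice that, the integrand is at most
  \<open>(2 ^ k * \<epsilon>) powr - p\<close>, while the volume grows like the power
  \<open>DIM('a)\<close> of the radius. The contributions thus decay like a geometric series of
  ratio \<open>2 powr - s\<close>.\<close>

lemma nn_integral_norm_powr_off_ball: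
  fixes x :: "'a::euclidean_space" and s :: real
  assumes "0 < s" "0 < \<epsilon>"
  shows "(\<integral>\<^sup>+y. ennreal (norm (y - x) powr - (DIM('a) + s)) * indicator {y. \<epsilon> < norm (y - x)} y
    \<partial>lborel) < \<infinity>"
proof -
  define p where "p = real DIM('a) + s"
  define C where "C = unit_ball_vol DIM('a) * 2 ^ DIM('a) * \<epsilon> powr - s"
  \<comment> \<open>The indicator is of the full outer ball instead of the shell: its volume has a
    closed form, and the overcount costs only a constant factor.\<close>
  define g where "g k y = ennreal ((2 ^ k * \<epsilon>) powr - p) * indicator (cball x (2 ^ Suc k * \<epsilon>)) y"
    for k :: nat and y :: 'a
  have [measurable]: "g k \<in> borel_measurable borel" for k
    unfolding g_def by (intro borel_measurable_times_ennreal borel_measurable_indicator) auto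
  have dyadic: "ennreal (norm (y - x) powr - p) * indicator {y. \<epsilon> < norm (y - x)} y \<le> (\<Sum>k. g k y)" for y
  proof (cases "\<epsilon> < norm (y - x)")
    case True
    define r where "r = norm (y - x) / \<epsilon>"
    \<comment> \<open>Index of the shell containing \<open>y\<close>; since \<open>r > 1\<close>,
      the logarithm is positive and \<open>nat\<close> truncates nothing.\<close>
    define k where "k = nat \<lfloor>log 2 r\<rfloor>"
    have r: "1 < r" using True assms by (simp add: r_def)
    then have "0 < log 2 r" by simp
    then have "real k \<le> log 2 r" "log 2 r < real k + 1"
      unfolding k_def by linarith+
    then have "2 powr k \<le> r" "r < 2 powr (real (Suc k))"
      using r by (simp_all add: le_log_iff log_less_iff add.commute)
    then have k: "2 ^ k * \<epsilon> \<le> norm (y - x)" "norm (y - x) < 2 ^ Suc k * \<epsilon>"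
      using assms by (simp_all only: powr_realpow zero_less_numeral r_def pos_le_divide_eq pos_divide_less_eq)
    have "norm (y - x) powr - p \<le> (2 ^ k * \<epsilon>) powr - p"
      using k assms by (intro powr_mono2') (auto simp: p_def)
    then have "ennreal (norm (y - x) powr - p) \<le> g k y"
      using k by (auto simp: g_def dist_norm norm_minus_commute intro!: ennreal_leI)
    also have "\<dots> \<le> (\<Sum>k. g k y)"
      using sum_le_suminf[of "\<lambda>k. g k y" "{k}"] by auto
    finally show ?thesis using True by simp
  qed auto
  have shell: "integral\<^sup>N lborel (g k) = ennreal (C * (2 powr - s) ^ k)" for k
  proof -
    define a where "a = 2 ^ k * \<epsilon>"
    have a: "0 < a" using assms by (simp add: a_def)
    have "integral\<^sup>N lborel (g k) = ennreal (a powr - p) * emeasure lborel (cball x (2 * a))"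
      unfolding g_def a_def by (subst nn_integral_cmult_indicator) (auto simp: mult.assoc)
    also have "\<dots> = ennreal (a powr - p * (unit_ball_vol DIM('a) * (2 * a) ^ DIM('a)))"
      using a by (simp add: emeasure_cball ennreal_mult')
    also have "a powr - p * (unit_ball_vol DIM('a) * (2 * a) ^ DIM('a))
        = unit_ball_vol DIM('a) * 2 ^ DIM('a) * (a powr - p * a powr DIM('a))"
      using a by (simp add: power_mult_distrib powr_realpow)
    \<comment> \<open>The volume growth cancels the dimension in \<open>p\<close>, leaving only the
      decay \<open>- s\<close>.\<close>
    also have "a powr - p * a powr DIM('a) = a powr - s"
      by (simp add: p_def flip: powr_add)
    also have "a powr - s = \<epsilon> powr - s * (2 powr - s) ^ k"
    proof -
      have "(2 powr - s) ^ k = (2 ^ k) powr - s"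
        by (simp add: powr_powr mult.commute flip: powr_realpow)
      then show ?thesis using assms by (simp add: a_def powr_mult)
    qed
    finally show ?thesis by (simp add: C_def mult.assoc)
  qed
  have "2 powr - s < 1"
    using assms powr_less_mono[of "- s" 0 2] by simp
  then have "summable (\<lambda>k. C * (2 powr - s) ^ k)"
    by (intro summable_mult summable_geometric) auto
  then have fin: "(\<Sum>k. ennreal (C * (2 powr - s) ^ k)) < \<infinity>"
    by (subst suminf_ennreal2) (auto simp: C_def)
  have "(\<integral>\<^sup>+y. ennreal (norm (y - x) powr - p) * indicator {y. \<epsilon> < norm (y - x)} y \<partial>lborel)
      \<le> (\<integral>\<^sup>+y. (\<Sum>k. g k y) \<partial>lborel)"
    by (intro nn_integral_mono dyadic)
  also have "\<dots> = (\<Sum>k. integral\<^sup>N lborel (g k))"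
    by (rule nn_integral_suminf) auto
  also have "\<dots> < \<infinity>"
    using fin by (simp add: shell)
  finally show ?thesis by (simp add: p_def)
qed

text \<open>Every truncated integral converges absolutely by the preceding estimate and vanishes by
  oddness about \<open>x\<close>, so the limit is that of a constant function.\<close>

lemma has_pv_integral_odd_kernel:
  fixes w x :: "'a::euclidean_space" and s :: real
  assumes "0 < s"
  shows "has_pv_integral (\<lambda>y. (w \<bullet> (y - x)) * norm (y - x) powr - (real DIM('a) + 1 + s)) x 0"
proof -
  define h where "h y = (w \<bullet> (y - x)) * norm (y - x) powr - (real DIM('a) + 1 + s)" for y
  have [measurable]: "h \<in> borel_measurable borel"
    unfolding h_def by measurable
  define H where "H \<epsilon> y = indicator {y. \<epsilon> < norm (y - x)} y *\<^sub>R h y" for \<epsilon> y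
  have [measurable]: "H \<epsilon> \<in> borel_measurable borel" for \<epsilon>
    unfolding H_def by measurable
  have bound: "\<bar>h y\<bar> \<le> norm w * norm (y - x) powr - (DIM('a) + s)" for y
  proof -
    have "\<bar>h y\<bar> \<le> (norm w * norm (y - x)) * norm (y - x) powr - (real DIM('a) + 1 + s)"
      unfolding h_def abs_mult
      by (intro mult_mono Cauchy_Schwarz_ineq2) auto
    \<comment> \<open>The factor from Cauchy-Schwarz raises the exponent by one; the identity also
      covers \<open>y = x\<close>, where both sides are 0.\<close>
    also have "\<dots> = norm w * norm (y - x) powr - (DIM('a) + s)"
      using powr_mult_base[of "norm (y - x)" "- (real DIM('a) + 1 + s)"] by (simp add: mult.assoc)
    finally show ?thesis .
  qed
  have int: "integrable lborel (H \<epsilon>)" if "0 < \<epsilon>" for \<epsilon>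
  proof (rule integrableI_bounded)
    have "(\<integral>\<^sup>+y. ennreal (norm (H \<epsilon> y)) \<partial>lborel) \<le> (\<integral>\<^sup>+y. ennreal (norm w) *
        (ennreal (norm (y - x) powr - (DIM('a) + s)) * indicator {y. \<epsilon> < norm (y - x)} y) \<partial>lborel)"
      using bound
      by (intro nn_integral_mono)
        (auto simp: H_def indicator_def ennreal_mult[symmetric] intro!: ennreal_leI)
    also have "\<dots> = ennreal (norm w) * (\<integral>\<^sup>+y. ennreal (norm (y - x) powr - (DIM('a) + s))
        * indicator {y. \<epsilon> < norm (y - x)} y \<partial>lborel)"
      by (rule nn_integral_cmult) measurable
    also have "\<dots> < \<infinity>"
      using nn_integral_norm_powr_off_ball[OF assms that, of x]
      by (simp add: ennreal_mult_less_top)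
    finally show "(\<integral>\<^sup>+y. ennreal (norm (H \<epsilon> y)) \<partial>lborel) < \<infinity>" .
  qed simp
  \<comment> \<open>The reflection with centre \<open>x\<close> is \<open>c - y\<close> for
    \<open>c = 2 *\<^sub>R x\<close>; it maps the complement of the ball to itself.\<close>
  have reflect: "H \<epsilon> (2 *\<^sub>R x - y) = - H \<epsilon> y" for \<epsilon> y
  proof -
    have "2 *\<^sub>R x - y - x = - (y - x)" by (simp add: scaleR_2)
    then show ?thesis
      by (simp only: H_def h_def indicator_def mem_Collect_eq norm_minus_cancel inner_minus_right)
        simp
  qed
  have "set_lebesgue_integral lebesgue {y. \<epsilon> < norm (y - x)} h = 0" for \<epsilon>
    using lborel_integral_odd_eq_0[of "H \<epsilon>", OF _ reflect]
    unfolding set_lebesgue_integral_def H_def[symmetric] by (subst integral_completion) auto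
  moreover have "set_integrable lebesgue {y. \<epsilon> < norm (y - x)} h" if "0 < \<epsilon>" for \<epsilon>
    using int[OF that] unfolding set_integrable_def H_def[symmetric]
    by (subst integrable_completion) auto
  ultimately show ?thesis
    unfolding h_def[symmetric] by (simp add: has_pv_integral_def)
qed

lemma has_pv_integral_add:
  assumes "has_pv_integral f x I" "has_pv_integral g x J"
  shows "has_pv_integral (\<lambda>y. f y + g y) x (I + J)"
proof -
  let ?A = "\<lambda>\<epsilon>. {y. \<epsilon> < norm (y - x)}"
  have int: "set_integrable lebesgue (?A \<epsilon>) f" "set_integrable lebesgue (?A \<epsilon>) g" if "0 < \<epsilon>" for \<epsilon>
    using assms that by (auto simp: has_pv_integral_def)
  have "((\<lambda>\<epsilon>. set_lebesgue_integral lebesgue (?A \<epsilon>) f + set_lebesgue_integral lebesgue (?A \<epsilon>) g)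
      \<longlongrightarrow> I + J) (at_right 0)"
    using assms by (intro tendsto_add) (auto simp: has_pv_integral_def)
  \<comment> \<open>Additivity rests on integrability, which is given for positive \<epsilon> only;
    agreement close to 0 from the right suffices for the limit.\<close>
  moreover have "\<forall>\<^sub>F \<epsilon> in at_right 0.
      set_lebesgue_integral lebesgue (?A \<epsilon>) f + set_lebesgue_integral lebesgue (?A \<epsilon>) g
      = set_lebesgue_integral lebesgue (?A \<epsilon>) (\<lambda>y. f y + g y)"
    using eventually_at_right_less by eventually_elim (simp add: int)
  ultimately show ?thesis
    unfolding has_pv_integral_def by (auto intro: int Lim_transform_eventually)
qed

text \<open>One direction adds \<open>g\<close>, the other adds \<open>- g\<close> to cancel it
  again. As an equivalence it also transfers the failure of a principal value to exist.\<close>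

lemma has_pv_integral_add_null_iff:
  assumes "has_pv_integral g x 0" "has_pv_integral (\<lambda>y. - g y) x 0"
  shows "has_pv_integral (\<lambda>y. f y + g y) x I \<longleftrightarrow> has_pv_integral f x I"
  using has_pv_integral_add[OF _ assms(1), of f I]
    has_pv_integral_add[OF _ assms(2), of "\<lambda>y. f y + g y" I] by auto

theorem theorem3p3:
  fixes s :: real
    and v :: "real ^ 'n \<Rightarrow> real ^ 'n"
    and u :: "real ^ 'n \<Rightarrow> real"
    and \<phi> :: "real \<Rightarrow> real"
    and \<omega> :: "real ^ 'n \<Rightarrow> real ^ 'n \<Rightarrow> real"
    and \<rho> \<alpha> :: "real ^ 'n \<Rightarrow> real ^ 'n \<Rightarrow> real ^ 'n"
  assumes "CARD('n) \<in> {1, 2, 3}"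
    and "0 < s" and "s < 1"
    and "v \<in> sobolev_H_vec s"
    and "u \<in> sobolev_H s"
    and "\<And>r. 0 < r \<Longrightarrow> \<phi> r = r powr (- (real CARD('n) + 1 + s))"
    and "\<And>x y. \<omega> x y = norm (y - x) * \<phi> (norm (y - x))"
    and "\<And>x y. \<rho> x y = (y - x) /\<^sub>R norm (y - x)"
    and "\<alpha> = interaction_kernel \<rho> \<infinity>"
  shows "\<forall>x. (pv_integrable (frac_div_integrand s v x) x
              \<longleftrightarrow> pv_integrable (nonlocal_div_integrand \<omega> \<alpha> v x) x)
           \<and> frac_div s v x = nonlocal_div \<omega> \<alpha> v x
           \<and> (pv_integrable (frac_grad_integrand s u x) x
              \<longleftrightarrow> pv_integrable (nonlocal_grad_integrand \<omega> \<alpha> u x) x)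
           \<and> frac_grad s u x = nonlocal_grad \<omega> \<alpha> u x"
proof (intro allI conjI)
  fix x
  let ?n = "real CARD('n)"
  \<comment> \<open>The values of \<phi> are prescribed at positive arguments only; at
    \<open>y = x\<close> the product vanishes anyway, because the direction vector is 0.\<close>
  have \<omega>\<alpha>: "\<omega> x y *\<^sub>R \<alpha> x y = norm (y - x) powr - (?n + 1 + s) *\<^sub>R (y - x)"
    and \<omega>_sym: "\<omega> y x = \<omega> x y" for y
    using assms(6)[of "norm (y - x)"]
    by (cases "y = x"; simp add: assms(7-9) interaction_kernel_def norm_minus_commute)+
  \<comment> \<open>Merges the normalisation of the direction with the singular kernel; at
    \<open>y = x\<close> both sides are 0 by division by zero and
    \<open>0 powr _ = 0\<close>.\<close>
  have powr_split: "a / norm (x - y) / norm (x - y) powr (?n + s)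
      = a * norm (y - x) powr - (?n + 1 + s)" for a y
    unfolding powr_minus_divide norm_minus_commute[of y x]
    by (cases "x = y") (simp_all add: powr_add mult_ac)
  have grad: "frac_grad_integrand s u x = nonlocal_grad_integrand \<omega> \<alpha> u x"
  proof
    fix y
    have "frac_grad_integrand s u x y
        = ((u x - u y) / norm (x - y) / norm (x - y) powr (?n + s)) *\<^sub>R (x - y)"
      by (simp add: frac_grad_integrand_def divide_inverse mult_ac)
    also have "\<dots> = (u y - u x) *\<^sub>R (\<omega> x y *\<^sub>R \<alpha> x y)"
      unfolding powr_split \<omega>\<alpha> by (simp add: algebra_simps)
    finally show "frac_grad_integrand s u x y = nonlocal_grad_integrand \<omega> \<alpha> u x y"
      by (simp add: nonlocal_grad_integrand_def)
  qed
  \<comment> \<open>Linear in \<open>w\<close>, this family contains both divergence integrands: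
    \<open>w = v y - v x\<close> is the fractional one and \<open>w = v x + v y\<close> the nonlocal
    one, so they differ by the fixed vector \<open>2 *\<^sub>R v x\<close>.\<close>
  define h where "h w y = (w \<bullet> (y - x)) * norm (y - x) powr - (?n + 1 + s)" for w y
  have h: "has_pv_integral (h w) x 0" for w
    using has_pv_integral_odd_kernel[OF assms(2), of w x] by (simp add: h_def[abs_def])
  have div: "nonlocal_div_integrand \<omega> \<alpha> v x = (\<lambda>y. frac_div_integrand s v x y + h (2 *\<^sub>R v x) y)"
  proof
    fix y
    have "frac_div_integrand s v x y
        = ((v x - v y) \<bullet> (x - y)) / norm (x - y) / norm (x - y) powr (?n + s)"
      by (simp add: frac_div_integrand_def divide_inverse mult_ac)
    also have "\<dots> = h (v y - v x) y"
      unfolding powr_split h_def by (simp add: algebra_simps)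
    finally have frac: "frac_div_integrand s v x y = h (v y - v x) y" .
    have "nonlocal_div_integrand \<omega> \<alpha> v x y = (v x + v y) \<bullet> (\<omega> x y *\<^sub>R \<alpha> x y)"
      by (simp add: nonlocal_div_integrand_def \<omega>_sym inner_add_left distrib_left)
    also have "\<dots> = h (v y - v x) y + h (2 *\<^sub>R v x) y"
      unfolding \<omega>\<alpha> h_def by (simp add: algebra_simps)
    finally show "nonlocal_div_integrand \<omega> \<alpha> v x y = frac_div_integrand s v x y + h (2 *\<^sub>R v x) y"
      by (simp add: frac)
  qed
  have "has_pv_integral (\<lambda>y. - h (2 *\<^sub>R v x) y) x 0"
    using h[of "- (2 *\<^sub>R v x)"] by (simp add: h_def[abs_def])
  \<comment> \<open>Holding for every \<open>I\<close>, this gives equal existence and equal values,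
    including the default 0 when no principal value exists.\<close>
  then have iff: "has_pv_integral (nonlocal_div_integrand \<omega> \<alpha> v x) x I
      \<longleftrightarrow> has_pv_integral (frac_div_integrand s v x) x I" for I
    unfolding div by (intro has_pv_integral_add_null_iff h)
  show "pv_integrable (frac_div_integrand s v x) x
      \<longleftrightarrow> pv_integrable (nonlocal_div_integrand \<omega> \<alpha> v x) x"
    and "frac_div s v x = nonlocal_div \<omega> \<alpha> v x"
    by (simp_all add: frac_div_def nonlocal_div_def pv_integral_def pv_integrable_def iff)
  show "pv_integrable (frac_grad_integrand s u x) x
      \<longleftrightarrow> pv_integrable (nonlocal_grad_integrand \<omega> \<alpha> u x) x"
    and "frac_grad s u x = nonlocal_grad \<omega> \<alpha> u x"
    by (simp_all add: frac_grad_def nonlocal_grad_def grad)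
qed

end
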